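(* Let $G$ be a simple connected bipartite graph with $n$ vertices and let $L_G$ be its Laplacian matrix. Then for all $\lambda\vdash n$, $\overline{\mathrm{imm}}_\lambda(L_G)\le \mathrm{perm}(L_G)$.
   Context: For $\lambda\vdash n$, $\chi_\lambda$ is the irreducible complex character of the symmetric group $\mathfrak{S}_n$ indexed by $\lambda$. The normalized immanant of a complex $n\times n$ matrix $A=(a_{i,j})$ is $\overline{\mathrm{imm}}_\lambda(A)=\frac{1}{\chi_\lambda(\mathrm{id})}\sum_{\psi\in\mathfrak{S}_n}\chi_\lambda(\psi)\prod_{i=1}^n a_{i,\psi(i)}$, and $\mathrm{perm}(A)=\sum_{\psi\in\mathfrak{S}_n}\prod_{i=1}^n a_{i,\psi(i)}$ is the permanent. The Laplacian matrix of a graph $G$ on vertex set $[n]$ is $L_G=D-A(G)$, with $D$ the diagonal matrix of degrees and $A(G)$ the adjacency matrix. *)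

theory Defs
  imports
    "Jordan_Normal_Form.Matrix"
    "Graph_Theory.Graph_Theory"
    "HOL-Combinatorics.Permutations"
    "HOL-Library.Function_Algebras"
    "HOL-Library.Complex_Order"
begin

text \<open>
  Conventions. The index set \<open>[n]\<close> is \<open>{0..<n}\<close>, matching the indexing of \<^typ>\<open>'a mat\<close>, and an
  element of the symmetric group is a function \<open>\<pi>\<close> with \<open>\<pi> permutes {0..<n}\<close>. The order on
  \<^typ>\<open>complex\<close> is the one of \<^theory>\<open>HOL-Library.Complex_Order\<close>: \<open>x \<le> y\<close> means that \<open>x\<close> and \<open>y\<close> have
  the same imaginary part and \<open>Re x \<le> Re y\<close>. Inverse permutations are written \<open>inv_into UNIV\<close> because
  HOL-Algebra claims the notation \<open>inv\<close> for group inverses.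
\<close>

section \<open>Partitions and Young diagrams\<close>

definition is_partition :: "nat list \<Rightarrow> nat \<Rightarrow> bool"  (infix \<open>\<turnstile>\<close> 50) where
  "lam \<turnstile> n \<longleftrightarrow> sorted_wrt (\<ge>) lam \<and> (\<forall>k \<in> set lam. 0 < k) \<and> sum_list lam = n"

text \<open>
  The cell (row, column) of the entry \<open>k < sum_list lam\<close> in the tableau of shape \<open>lam\<close> that is filled
  with \<open>0, 1, 2, \<dots>\<close> row by row. The value for larger \<open>k\<close> is irrelevant.
\<close>

fun tableau_cell :: "nat list \<Rightarrow> nat \<Rightarrow> nat \<times> nat" where
  "tableau_cell [] k = (0, k)"
| "tableau_cell (l # ls) k =
     (if k < l then (0, k) else (case tableau_cell ls (k - l) of (r, c) \<Rightarrow> (Suc r, c)))"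

definition row_group :: "nat list \<Rightarrow> (nat \<Rightarrow> nat) set" where
  "row_group lam = {p. p permutes {0..<sum_list lam} \<and>
     (\<forall>k < sum_list lam. fst (tableau_cell lam (p k)) = fst (tableau_cell lam k))}"

definition column_group :: "nat list \<Rightarrow> (nat \<Rightarrow> nat) set" where
  "column_group lam = {q. q permutes {0..<sum_list lam} \<and>
     (\<forall>k < sum_list lam. snd (tableau_cell lam (q k)) = snd (tableau_cell lam k))}"

section \<open>The group algebra of the symmetric group\<close>

text \<open>
  An element \<open>\<Sum>\<pi>. f \<pi> \<cdot> \<pi>\<close> of the complex group algebra is represented by its coefficient function
  \<open>f\<close>, which vanishes off the permutations of \<open>{0..<n}\<close>. Multiplication is convolution.
\<close>

definition group_algebra :: "nat \<Rightarrow> ((nat \<Rightarrow> nat) \<Rightarrow> complex) set" where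
  "group_algebra n = {f. \<forall>\<pi>. \<not> \<pi> permutes {0..<n} \<longrightarrow> f \<pi> = 0}"

definition group_algebra_mult ::
  "nat \<Rightarrow> ((nat \<Rightarrow> nat) \<Rightarrow> complex) \<Rightarrow> ((nat \<Rightarrow> nat) \<Rightarrow> complex) \<Rightarrow> (nat \<Rightarrow> nat) \<Rightarrow> complex" where
  "group_algebra_mult n f g = (\<lambda>\<pi>. if \<pi> permutes {0..<n}
     then \<Sum>\<sigma> | \<sigma> permutes {0..<n}. f \<sigma> * g (inv_into UNIV \<sigma> \<circ> \<pi>) else 0)"

text \<open>Left multiplication by the basis element \<open>\<sigma>\<close>.\<close>

definition left_translate ::
  "(nat \<Rightarrow> nat) \<Rightarrow> ((nat \<Rightarrow> nat) \<Rightarrow> complex) \<Rightarrow> (nat \<Rightarrow> nat) \<Rightarrow> complex" where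
  "left_translate \<sigma> f = (\<lambda>\<pi>. f (inv_into UNIV \<sigma> \<circ> \<pi>))"

section \<open>Irreducible characters of the symmetric group\<close>

text \<open>
  The irreducible representation indexed by \<open>lam\<close> is the left ideal (Specht module) generated by the
  Young symmetrizer \<open>(\<Sum>p \<in> row_group lam. p) * (\<Sum>q \<in> column_group lam. sign q \<cdot> q)\<close>. With this
  convention the one-row partition indexes the trivial and the one-column partition the sign representation.
\<close>

definition young_symmetrizer :: "nat list \<Rightarrow> (nat \<Rightarrow> nat) \<Rightarrow> complex" where
  "young_symmetrizer lam = group_algebra_mult (sum_list lam)
     (\<lambda>p. if p \<in> row_group lam then 1 else 0)
     (\<lambda>q. if q \<in> column_group lam then of_int (sign q) else 0)"

definition specht_module :: "nat list \<Rightarrow> ((nat \<Rightarrow> nat) \<Rightarrow> complex) set" where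
  "specht_module lam = (\<lambda>f. group_algebra_mult (sum_list lam) f (young_symmetrizer lam))
     ` group_algebra (sum_list lam)"

interpretation fun_space: vector_space "\<lambda>(c::complex) (f :: 'a \<Rightarrow> complex) x. c * f x"
  by unfold_locales (auto simp: fun_eq_iff algebra_simps)

text \<open>
  Trace of a linear endomorphism \<open>T\<close> of a finite-dimensional space \<open>V\<close> of complex functions: the sum of
  the diagonal coefficients of \<open>T\<close> in some basis of \<open>V\<close> (the value does not depend on the choice).
\<close>

definition trace_on ::
  "('a \<Rightarrow> complex) set \<Rightarrow> (('a \<Rightarrow> complex) \<Rightarrow> 'a \<Rightarrow> complex) \<Rightarrow> complex" where
  "trace_on V T = (let B = (SOME B. fun_space.independent B \<and> fun_space.span B = V)
     in \<Sum>b \<in> B. fun_space.representation B (T b) b)"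

definition irr_character :: "nat list \<Rightarrow> (nat \<Rightarrow> nat) \<Rightarrow> complex" where
  "irr_character lam \<sigma> = trace_on (specht_module lam) (left_translate \<sigma>)"

section \<open>Immanants\<close>

definition permanent :: "complex mat \<Rightarrow> complex" where
  "permanent A = (\<Sum>\<psi> | \<psi> permutes {0..<dim_row A}. \<Prod>i = 0..<dim_row A. A $$ (i, \<psi> i))"

definition normalized_immanant :: "nat list \<Rightarrow> complex mat \<Rightarrow> complex" where
  "normalized_immanant lam A = 1 / irr_character lam id *
     (\<Sum>\<psi> | \<psi> permutes {0..<dim_row A}.
        irr_character lam \<psi> * (\<Prod>i = 0..<dim_row A. A $$ (i, \<psi> i)))"

section \<open>Graphs\<close>

text \<open>
  A simple graph is a \<^const>\<open>pair_graph\<close>: finite, loop-free, without parallel arcs, and symmetric, so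
  that an edge \<open>{u, v}\<close> is the pair of arcs \<open>(u, v)\<close> and \<open>(v, u)\<close>. Hence the degree of a vertex is its
  out-degree.
\<close>

definition bipartite :: "'a pair_pre_digraph \<Rightarrow> bool" where
  "bipartite G \<longleftrightarrow> (\<exists>U W. U \<union> W = pverts G \<and> U \<inter> W = {} \<and> parcs G \<subseteq> U \<times> W \<union> W \<times> U)"

definition degree_matrix :: "nat \<Rightarrow> nat pair_pre_digraph \<Rightarrow> complex mat" where
  "degree_matrix n G =
     mat n n (\<lambda>(i, j). if i = j then of_nat (out_degree (with_proj G) i) else 0)"

definition adjacency_matrix :: "nat \<Rightarrow> nat pair_pre_digraph \<Rightarrow> complex mat" where
  "adjacency_matrix n G = mat n n (\<lambda>(i, j). if (i, j) \<in> parcs G then 1 else 0)"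

definition laplacian_matrix :: "nat \<Rightarrow> nat pair_pre_digraph \<Rightarrow> complex mat" where
  "laplacian_matrix n G = degree_matrix n G - adjacency_matrix n G"

end

theory Submission
  imports Defs
begin

text \<open>
  Two independent facts combine. First, the vertices of a bipartite graph carry signs \<open>s\<close>, constant
  on either side, such that \<open>s i * s j * L (i, j) \<ge> 0\<close> for all \<open>i\<close> and \<open>j\<close>. In the product of the
  entries \<open>L (i, \<psi> i)\<close> over all \<open>i\<close> every vertex occurs once as a row and once as a column, so the
  signs cancel and each summand of the permanent is nonnegative
  (\<open>bipartite_laplacian_diagonal_product_nonneg\<close>). Secondly, a character \<open>\<chi>\<close> of a finite group satisfies
  \<open>Re (\<chi> \<psi>) \<le> \<chi> id\<close>, which bounds the real part of the normalized immanant summand by summand.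
  Since the order on complex numbers also compares imaginary parts, the immanant has to be real: this
  follows from \<open>\<chi> (\<psi>\<^sup>-\<^sup>1) = cnj (\<chi> \<psi>)\<close> and the symmetry of the matrix, by pairing \<open>\<psi>\<close> with its inverse.

  The two properties of characters are shared by all spaces \<open>V\<close> of functions on a finite set \<open>X\<close>
  that are stable under composition with bijections \<open>\<tau>\<close> of \<open>X\<close>; here \<open>X\<close> consists of the
  permutations, \<open>V\<close> is the Specht module and \<open>\<tau>\<close> a left translation. Let \<open>p x\<close> be the orthogonal projection to \<open>V\<close> of the indicator
  function of \<open>x\<close>. These functions form the reproducing kernel of \<open>V\<close>, that is, \<open>v x\<close> is the inner
  product of \<open>v\<close> and \<open>p x\<close>, and the trace of \<open>f \<mapsto> f \<circ> \<tau>\<close> on \<open>V\<close>, computed in any basis, is the sum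
  of \<open>p x (\<tau> x)\<close> over \<open>X\<close> (\<open>trace_on_composition\<close>). Because \<open>p x y\<close> is the inner product of \<open>p x\<close>
  and \<open>p y\<close>, the kernel is hermitian, which gives the inverse rule, and the inequality
  \<open>2 * Re \<langle>u, v\<rangle> \<le> \<langle>u, u\<rangle> + \<langle>v, v\<rangle>\<close> gives the bound.
\<close>

section \<open>Orthogonal projection in spaces of functions on a finite set\<close>

lemma sum_fun_apply: "(\<Sum>i\<in>I. F i) x = (\<Sum>i\<in>I. F i x :: complex)"
  by (induction I rule: infinite_finite_induct) auto

definition inner_on :: "'a set \<Rightarrow> ('a \<Rightarrow> complex) \<Rightarrow> ('a \<Rightarrow> complex) \<Rightarrow> complex" where
  "inner_on X f g = (\<Sum>x\<in>X. f x * cnj (g x))"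

lemma inner_on_add_left: "inner_on X (f + g) h = inner_on X f h + inner_on X g h"
  by (simp add: inner_on_def algebra_simps sum.distrib)

lemma inner_on_diff_left: "inner_on X (f - g) h = inner_on X f h - inner_on X g h"
  by (simp add: inner_on_def algebra_simps sum_subtractf)

lemma inner_on_scale_left: "inner_on X (\<lambda>x. c * f x) h = c * inner_on X f h"
  by (simp add: inner_on_def sum_distrib_left mult.assoc)

lemma inner_on_commute: "inner_on X g f = cnj (inner_on X f g)"
  by (simp add: inner_on_def mult.commute)

lemma inner_on_add_right: "inner_on X h (f + g) = inner_on X h f + inner_on X h g"
  by (simp add: inner_on_def algebra_simps sum.distrib)

lemma inner_on_scale_right: "inner_on X h (\<lambda>x. c * f x) = cnj c * inner_on X h f"
  by (simp add: inner_on_def sum_distrib_left mult_ac)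

lemma inner_on_self: "inner_on X f f = of_real (\<Sum>x\<in>X. (cmod (f x))\<^sup>2)"
  unfolding inner_on_def of_real_sum
  by (rule sum.cong) (simp_all only: complex_norm_square)

lemma inner_on_self_eq_0:
  assumes "finite X" "inner_on X u u = 0"
  shows "inner_on X f u = 0"
proof -
  have "(\<Sum>x\<in>X. (cmod (u x))\<^sup>2) = 0"
    using assms(2) unfolding inner_on_self by (simp only: of_real_eq_0_iff)
  then have "\<forall>x\<in>X. u x = 0"
    using assms(1) by (simp add: sum_nonneg_eq_0_iff)
  then show ?thesis by (simp add: inner_on_def)
qed

lemma Re_inner_on_le:
  "Re (inner_on X f g) \<le> (Re (inner_on X f f) + Re (inner_on X g g)) / 2"
proof -
  have "Re (a * cnj b) \<le> ((cmod a)\<^sup>2 + (cmod b)\<^sup>2) / 2" for a b :: complex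
  proof -
    have "0 \<le> (Re a - Re b)\<^sup>2 + (Im a - Im b)\<^sup>2" by simp
    then show ?thesis unfolding cmod_power2 by (simp add: power2_eq_square algebra_simps)
  qed
  then have "Re (inner_on X f g) \<le> (\<Sum>x\<in>X. ((cmod (f x))\<^sup>2 + (cmod (g x))\<^sup>2) / 2)"
    unfolding inner_on_def Re_sum by (intro sum_mono)
  also have "\<dots> = (Re (inner_on X f f) + Re (inner_on X g g)) / 2"
    unfolding inner_on_self by (simp add: sum.distrib flip: sum_divide_distrib)
  finally show ?thesis .
qed

text \<open>
  One step of the Gram-Schmidt process: to enlarge the span by \<open>b\<close>, correct the old projection of \<open>f\<close>
  along the component \<open>u\<close> of \<open>b\<close> that is orthogonal to the old span.
\<close>

lemma orthogonal_projection_exists: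
  assumes "finite X" "finite B"
  shows "\<exists>p \<in> fun_space.span B. \<forall>g \<in> fun_space.span B. inner_on X (f - p) g = 0"
  using assms(2)
proof (induction B arbitrary: f rule: finite_induct)
  case empty
  then show ?case by (simp add: fun_space.span_empty inner_on_def)
next
  case (insert b B)
  obtain q where q: "q \<in> fun_space.span B" "\<forall>g \<in> fun_space.span B. inner_on X (b - q) g = 0"
    using insert.IH by blast
  obtain p where p: "p \<in> fun_space.span B" "\<forall>g \<in> fun_space.span B. inner_on X (f - p) g = 0"
    using insert.IH by blast
  define u where "u = b - q"
  define c where "c = inner_on X f u / inner_on X u u"
  have sub: "fun_space.span B \<subseteq> fun_space.span (insert b B)"
    by (rule fun_space.span_mono) auto
  have u: "u \<in> fun_space.span (insert b B)"
    unfolding u_def using q(1) sub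
    by (intro fun_space.span_diff) (auto intro: fun_space.span_base)
  have pu: "inner_on X p u = 0"
    using q(2) p(1) by (subst inner_on_commute) (simp add: u_def)
  \<comment> \<open>If the quotient \<open>c\<close> has denominator zero, then \<open>u\<close> vanishes on \<open>X\<close> and both sides are zero.\<close>
  have cu: "inner_on X f u = c * inner_on X u u"
    using inner_on_self_eq_0[OF assms(1), of u f] by (cases "inner_on X u u = 0") (auto simp: c_def)
  show ?case
  proof (intro bexI ballI)
    show "p + (\<lambda>x. c * u x) \<in> fun_space.span (insert b B)"
      using p(1) sub u by (intro fun_space.span_add fun_space.span_scale) auto
  next
    fix g assume "g \<in> fun_space.span (insert b B)"
    then obtain k where k: "g - (\<lambda>x. k * b x) \<in> fun_space.span B"
      by (auto simp: fun_space.span_breakdown_eq)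
    define h where "h = (g - (\<lambda>x. k * b x)) + (\<lambda>x. k * q x)"
    have h: "h \<in> fun_space.span B"
      unfolding h_def using k q(1) by (intro fun_space.span_add fun_space.span_scale) auto
    have g: "g = (\<lambda>x. k * u x) + h"
      by (auto simp: h_def u_def fun_eq_iff algebra_simps)
    have "inner_on X (f - (p + (\<lambda>x. c * u x))) v
        = inner_on X (f - p) v - c * inner_on X u v" for v
      by (simp add: inner_on_add_left inner_on_diff_left inner_on_scale_left)
    moreover have "inner_on X (f - p) h = 0" "inner_on X u h = 0"
      using p(2) q(2) h by (simp_all add: u_def)
    moreover have "inner_on X (f - p) u = c * inner_on X u u"
      using pu cu by (simp add: inner_on_diff_left)
    ultimately show "inner_on X (f - (p + (\<lambda>x. c * u x))) g = 0"
      unfolding g inner_on_add_right inner_on_scale_right by simp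
  qed
qed

section \<open>Traces and reproducing kernels\<close>

definition reproducing_kernel ::
  "'a set \<Rightarrow> ('a \<Rightarrow> complex) set \<Rightarrow> ('a \<Rightarrow> 'a \<Rightarrow> complex) \<Rightarrow> bool" where
  "reproducing_kernel X V p \<longleftrightarrow>
     (\<forall>x\<in>X. p x \<in> V \<and> (\<forall>v\<in>V. inner_on X v (p x) = v x))"

text \<open>
  The first part makes the choice of a basis in \<^const>\<open>trace_on\<close> well defined; the second turns
  expansions in the chosen basis into finite sums.
\<close>

lemma finite_basis_exists:
  assumes "finite X" "fun_space.subspace V" "V \<subseteq> {f. \<forall>x. x \<notin> X \<longrightarrow> f x = 0}"
  shows "\<exists>B. fun_space.independent B \<and> fun_space.span B = V"
    and "fun_space.independent B \<Longrightarrow> fun_space.span B = V \<Longrightarrow> finite B"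
proof -
  obtain B where "B \<subseteq> V" "fun_space.independent B" "V \<subseteq> fun_space.span B"
    using fun_space.maximal_independent_subset by blast
  moreover have "fun_space.span B \<subseteq> V"
    using calculation(1) assms(2) by (rule fun_space.span_minimal)
  ultimately show "\<exists>B. fun_space.independent B \<and> fun_space.span B = V" by blast
next
  assume B: "fun_space.independent B" "fun_space.span B = V"
  let ?D = "(\<lambda>x y. of_bool (y = x) :: complex) ` X"
  have "f \<in> fun_space.span ?D" if "f \<in> V" for f
  proof -
    have "f = (\<Sum>x\<in>X. (\<lambda>y. f x * of_bool (y = x)))"
    proof
      fix y
      show "f y = (\<Sum>x\<in>X. (\<lambda>y. f x * of_bool (y = x))) y"
        using assms(1,3) that by (cases "y \<in> X") (auto simp: sum_fun_apply)
    qed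
    also have "\<dots> \<in> fun_space.span ?D"
      by (intro fun_space.span_sum fun_space.span_scale fun_space.span_base) auto
    finally show ?thesis .
  qed
  then have "B \<subseteq> fun_space.span ?D"
    using B(2) fun_space.span_superset by blast
  then show "finite B"
    using fun_space.independent_span_bound[of ?D B] assms(1) B(1) by blast
qed

text \<open>
  The value \<open>v x\<close> is the inner product of \<open>v\<close> with the indicator function of \<open>x\<close>, and for \<open>v \<in> V\<close>
  this function may be replaced by its orthogonal projection to \<open>V\<close>.
\<close>

lemma reproducing_kernel_exists:
  assumes "finite X" "fun_space.subspace V" "V \<subseteq> {f. \<forall>x. x \<notin> X \<longrightarrow> f x = 0}"
  shows "\<exists>p. reproducing_kernel X V p"
proof -
  obtain B where B: "fun_space.span B = V" "finite B"
    using finite_basis_exists[OF assms] by blast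
  have "\<exists>p \<in> V. \<forall>v\<in>V. inner_on X v p = v x" if "x \<in> X" for x
  proof -
    let ?d = "\<lambda>y. of_bool (y = x) :: complex"
    obtain p where p: "p \<in> V" "\<forall>v\<in>V. inner_on X (?d - p) v = 0"
      using orthogonal_projection_exists[OF assms(1) B(2), of ?d] B(1) by auto
    have "inner_on X v p = v x" if "v \<in> V" for v
    proof -
      have "inner_on X p v = inner_on X ?d v"
        using p(2) that by (simp add: inner_on_diff_left)
      also have "\<dots> = cnj (v x)"
        using \<open>x \<in> X\<close> assms(1) by (simp add: inner_on_def)
      finally show ?thesis by (simp add: inner_on_commute[of X v p])
    qed
    with p(1) show ?thesis by blast
  qed
  then show ?thesis unfolding reproducing_kernel_def by metis
qed

lemma reproducing_kernel_inner:
  assumes "reproducing_kernel X V p" "x \<in> X" "y \<in> X"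
  shows "inner_on X (p x) (p y) = p x y"
  using assms by (simp add: reproducing_kernel_def)

lemma reproducing_kernel_hermitian:
  assumes "reproducing_kernel X V p" "x \<in> X" "y \<in> X"
  shows "p y x = cnj (p x y)"
  using assms inner_on_commute[of X "p y" "p x"] by (simp add: reproducing_kernel_inner)

text \<open>
  The reproducing property expands each \<open>v \<in> V\<close> as the sum of \<open>v x\<close> times \<open>p x\<close>, so a coordinate of
  \<open>b \<circ> \<tau>\<close> is the sum of \<open>b (\<tau> x)\<close> times that coordinate of \<open>p x\<close>. After exchanging the sums over
  the basis and over \<open>X\<close>, the inner sum is the basis expansion of \<open>p x\<close>, evaluated at \<open>\<tau> x\<close>. Hence the
  trace does not depend on the basis.
\<close>

lemma trace_on_composition:
  assumes "finite X" "fun_space.subspace V" "V \<subseteq> {f. \<forall>x. x \<notin> X \<longrightarrow> f x = 0}"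
    and p: "reproducing_kernel X V p"
    and invariant: "\<And>f. f \<in> V \<Longrightarrow> (\<lambda>x. f (\<tau> x)) \<in> V"
  shows "trace_on V (\<lambda>f x. f (\<tau> x)) = (\<Sum>x\<in>X. p x (\<tau> x))"
proof -
  define B where "B = (SOME B. fun_space.independent B \<and> fun_space.span B = V)"
  have B: "fun_space.independent B" "fun_space.span B = V"
    unfolding B_def using someI_ex[OF finite_basis_exists(1)[OF assms(1-3)]] by blast+
  have finB: "finite B"
    using finite_basis_exists(2)[OF assms(1-3) B] .
  have pV: "p x \<in> V" if "x \<in> X" for x
    using p that by (simp add: reproducing_kernel_def)
  let ?c = "fun_space.representation B"
  have expand: "v = (\<Sum>x\<in>X. (\<lambda>y. v x * p x y))" if v: "v \<in> V" for v
  proof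
    fix y
    show "v y = (\<Sum>x\<in>X. (\<lambda>y. v x * p x y)) y"
    proof (cases "y \<in> X")
      case True
      then have "v y = (\<Sum>x\<in>X. v x * cnj (p y x))"
        using p v by (simp add: reproducing_kernel_def inner_on_def)
      also have "\<dots> = (\<Sum>x\<in>X. v x * p x y)"
        using reproducing_kernel_hermitian[OF p True] by (intro sum.cong) auto
      finally show ?thesis by (simp add: sum_fun_apply)
    next
      case False
      then have "v y = 0" "\<And>x. x \<in> X \<Longrightarrow> p x y = 0" using assms(3) v pV by blast+
      then show ?thesis by (simp add: sum_fun_apply)
    qed
  qed
  have coeff: "?c v b = (\<Sum>x\<in>X. v x * ?c (p x) b)" if v: "v \<in> V" for v b
  proof -
    have "?c v = ?c (\<Sum>x\<in>X. (\<lambda>y. v x * p x y))"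
      using expand[OF v] by simp
    also have "\<dots> = (\<lambda>b. \<Sum>x\<in>X. ?c (\<lambda>y. v x * p x y) b)"
      using B pV by (intro fun_space.representation_sum) (auto intro: fun_space.span_scale)
    also have "\<dots> = (\<lambda>b. \<Sum>x\<in>X. v x * ?c (p x) b)"
      using B pV by (intro ext sum.cong) (auto simp: fun_space.representation_scale)
    finally show ?thesis by simp
  qed
  have "trace_on V (\<lambda>f x. f (\<tau> x)) = (\<Sum>b\<in>B. ?c (\<lambda>x. b (\<tau> x)) b)"
    unfolding trace_on_def B_def Let_def ..
  also have "\<dots> = (\<Sum>b\<in>B. \<Sum>x\<in>X. b (\<tau> x) * ?c (p x) b)"
    using B(2) fun_space.span_superset[of B] by (intro sum.cong coeff invariant) auto
  also have "\<dots> = (\<Sum>x\<in>X. \<Sum>b\<in>B. ?c (p x) b * b (\<tau> x))"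
    by (subst sum.swap) (simp add: mult.commute)
  also have "\<dots> = (\<Sum>x\<in>X. p x (\<tau> x))"
  proof (intro sum.cong refl)
    fix x assume "x \<in> X"
    then have "(\<Sum>b\<in>B. (\<lambda>y. ?c (p x) b * b y)) = p x"
      using fun_space.sum_representation_eq[OF B(1) _ finB, of "p x"] B(2) pV by auto
    then show "(\<Sum>b\<in>B. ?c (p x) b * b (\<tau> x)) = p x (\<tau> x)"
      by (metis (no_types, lifting) sum_fun_apply sum.cong)
  qed
  finally show ?thesis .
qed

text \<open>Reindexing by \<open>\<tau>\<close> exchanges the two arguments of the hermitian kernel.\<close>

lemma sum_kernel_inverse:
  assumes p: "reproducing_kernel X V p"
    and "bij_betw \<tau> X X" and inverse: "\<And>x. x \<in> X \<Longrightarrow> \<tau>' (\<tau> x) = x"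
  shows "(\<Sum>x\<in>X. p x (\<tau>' x)) = cnj (\<Sum>x\<in>X. p x (\<tau> x))"
proof -
  have "(\<Sum>x\<in>X. p x (\<tau>' x)) = (\<Sum>x\<in>X. p (\<tau> x) (\<tau>' (\<tau> x)))"
    using sum.reindex_bij_betw[OF assms(2), of "\<lambda>x. p x (\<tau>' x)"] by simp
  also have "\<dots> = (\<Sum>x\<in>X. cnj (p x (\<tau> x)))"
    using assms(2) inverse
    by (intro sum.cong) (auto simp: bij_betw_apply intro: reproducing_kernel_hermitian[OF p])
  finally show ?thesis by simp
qed

text \<open>
  The real part of \<open>p x (\<tau> x)\<close> is at most the mean of \<open>p x x\<close> and \<open>p (\<tau> x) (\<tau> x)\<close>, and as \<open>\<tau>\<close>
  permutes \<open>X\<close>, both have the same sum over \<open>X\<close>.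
\<close>

lemma Re_sum_kernel_le:
  assumes p: "reproducing_kernel X V p" and bij: "bij_betw \<tau> X X"
  shows "Re (\<Sum>x\<in>X. p x (\<tau> x)) \<le> Re (\<Sum>x\<in>X. p x x)"
proof -
  have "Re (\<Sum>x\<in>X. p x (\<tau> x)) \<le> (\<Sum>x\<in>X. (Re (p x x) + Re (p (\<tau> x) (\<tau> x))) / 2)"
    unfolding Re_sum
  proof (rule sum_mono)
    fix x assume "x \<in> X"
    then show "Re (p x (\<tau> x)) \<le> (Re (p x x) + Re (p (\<tau> x) (\<tau> x))) / 2"
      using Re_inner_on_le[of X "p x" "p (\<tau> x)"] bij_betw_apply[OF bij]
      by (simp add: reproducing_kernel_inner[OF p])
  qed
  also have "\<dots> = Re (\<Sum>x\<in>X. p x x)"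
    using sum.reindex_bij_betw[OF bij, of "\<lambda>x. Re (p x x)"]
    by (simp add: sum.distrib flip: sum_divide_distrib)
  finally show ?thesis .
qed

section \<open>Specht modules and their characters\<close>

lemma permutes_comp_iff:
  assumes "\<sigma> permutes S"
  shows "\<sigma> \<circ> \<pi> permutes S \<longleftrightarrow> \<pi> permutes S"
proof
  assume "\<sigma> \<circ> \<pi> permutes S"
  then have "inv_into UNIV \<sigma> \<circ> (\<sigma> \<circ> \<pi>) permutes S"
    using permutes_compose permutes_inv assms by blast
  then show "\<pi> permutes S"
    by (simp add: o_assoc permutes_inv_o[OF assms])
qed (use assms permutes_compose in blast)

lemma bij_betw_permutes_comp:
  assumes "\<sigma> permutes S"
  shows "bij_betw (\<lambda>\<pi>. \<sigma> \<circ> \<pi>) {\<pi>. \<pi> permutes S} {\<pi>. \<pi> permutes S}"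
  by (rule bij_betw_byWitness[where f' = "\<lambda>\<pi>. inv_into UNIV \<sigma> \<circ> \<pi>"])
    (auto simp: o_assoc permutes_inv_o[OF assms] permutes_comp_iff assms permutes_inv)

text \<open>
  This is associativity in the group algebra, for a product whose left factor is a group element; it
  makes Specht modules, being left ideals, invariant under left translation.
\<close>

lemma left_translate_mult:
  assumes \<sigma>: "\<sigma> permutes {0..<n}"
  shows "left_translate \<sigma> (group_algebra_mult n f g)
    = group_algebra_mult n (left_translate \<sigma> f) g"
proof
  fix \<pi>
  let ?P = "{\<rho>. \<rho> permutes {0..<n}}" and ?i = "inv_into UNIV \<sigma>"
  have iff: "?i \<circ> \<pi> permutes {0..<n} \<longleftrightarrow> \<pi> permutes {0..<n}"
    by (intro permutes_comp_iff permutes_inv \<sigma>)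
  have "(\<Sum>\<rho>\<in>?P. f (?i \<circ> \<rho>) * g (inv_into UNIV \<rho> \<circ> \<pi>))
      = (\<Sum>\<rho>\<in>?P. f (?i \<circ> (\<sigma> \<circ> \<rho>)) * g (inv_into UNIV (\<sigma> \<circ> \<rho>) \<circ> \<pi>))"
    by (rule sum.reindex_bij_betw[OF bij_betw_permutes_comp[OF \<sigma>], symmetric])
  also have "\<dots> = (\<Sum>\<rho>\<in>?P. f \<rho> * g (inv_into UNIV \<rho> \<circ> (?i \<circ> \<pi>)))"
  proof (intro sum.cong refl)
    fix \<rho> assume "\<rho> \<in> ?P"
    then have "inv_into UNIV (\<sigma> \<circ> \<rho>) = inv_into UNIV \<rho> \<circ> ?i"
      using \<sigma> by (simp add: o_inv_distrib permutes_bij)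
    then show "f (?i \<circ> (\<sigma> \<circ> \<rho>)) * g (inv_into UNIV (\<sigma> \<circ> \<rho>) \<circ> \<pi>)
      = f \<rho> * g (inv_into UNIV \<rho> \<circ> (?i \<circ> \<pi>))"
      by (simp add: o_assoc permutes_inv_o[OF \<sigma>])
  qed
  finally show "left_translate \<sigma> (group_algebra_mult n f g) \<pi>
    = group_algebra_mult n (left_translate \<sigma> f) g \<pi>"
    by (simp add: left_translate_def group_algebra_mult_def iff)
qed

lemma specht_module_supported:
  assumes "f \<in> specht_module lam" "\<not> \<pi> permutes {0..<sum_list lam}"
  shows "f \<pi> = 0"
  using assms by (auto simp: specht_module_def group_algebra_mult_def)

lemma subspace_specht_module: "fun_space.subspace (specht_module lam)"
proof -
  let ?n = "sum_list lam"
  have "(\<lambda>_. 0) = group_algebra_mult ?n (\<lambda>_. 0) g"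
    "group_algebra_mult ?n f g + group_algebra_mult ?n f' g = group_algebra_mult ?n (f + f') g"
    "(\<lambda>\<pi>. c * group_algebra_mult ?n f g \<pi>) = group_algebra_mult ?n (\<lambda>\<pi>. c * f \<pi>) g"
    for f f' g and c :: complex
    by (auto simp: group_algebra_mult_def fun_eq_iff algebra_simps sum.distrib sum_distrib_left)
  moreover have "(\<lambda>_. 0) \<in> group_algebra ?n"
    "f \<in> group_algebra ?n \<Longrightarrow> f' \<in> group_algebra ?n \<Longrightarrow> f + f' \<in> group_algebra ?n"
    "f \<in> group_algebra ?n \<Longrightarrow> (\<lambda>\<pi>. c * f \<pi>) \<in> group_algebra ?n" for f f' c
    by (auto simp: group_algebra_def)
  ultimately show ?thesis
    unfolding fun_space.subspace_def specht_module_def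
    by (fastforce simp: zero_fun_def)
qed

lemma left_translate_specht_module:
  assumes \<sigma>: "\<sigma> permutes {0..<sum_list lam}" and "f \<in> specht_module lam"
  shows "left_translate \<sigma> f \<in> specht_module lam"
proof -
  have "left_translate \<sigma> h \<in> group_algebra (sum_list lam)"
    if "h \<in> group_algebra (sum_list lam)" for h
    using that permutes_comp_iff[OF permutes_inv[OF \<sigma>]]
    by (auto simp: group_algebra_def left_translate_def)
  then show ?thesis
    using assms(2) by (auto simp: specht_module_def left_translate_mult[OF \<sigma>])
qed

lemma irr_character_kernel:
  obtains p where "reproducing_kernel {\<pi>. \<pi> permutes {0..<sum_list lam}} (specht_module lam) p"
    and "\<And>\<sigma>. \<sigma> permutes {0..<sum_list lam} \<Longrightarrow> irr_character lam \<sigma>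
      = (\<Sum>\<pi> | \<pi> permutes {0..<sum_list lam}. p \<pi> (inv_into UNIV \<sigma> \<circ> \<pi>))"
proof -
  let ?X = "{\<pi>. \<pi> permutes {0..<sum_list lam}}"
  have fin: "finite ?X" by (simp add: finite_permutations)
  have supp: "specht_module lam \<subseteq> {f. \<forall>x. x \<notin> ?X \<longrightarrow> f x = 0}"
    using specht_module_supported by auto
  obtain p where p: "reproducing_kernel ?X (specht_module lam) p"
    using reproducing_kernel_exists[OF fin subspace_specht_module supp] by blast
  show thesis
  proof (rule that[OF p])
    fix \<sigma> assume "\<sigma> permutes {0..<sum_list lam}"
    then have "trace_on (specht_module lam) (\<lambda>f \<pi>. f (inv_into UNIV \<sigma> \<circ> \<pi>))
        = (\<Sum>\<pi>\<in>?X. p \<pi> (inv_into UNIV \<sigma> \<circ> \<pi>))"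
      using left_translate_specht_module
      by (intro trace_on_composition[OF fin subspace_specht_module supp p])
        (auto simp: left_translate_def)
    then show "irr_character lam \<sigma> = (\<Sum>\<pi>\<in>?X. p \<pi> (inv_into UNIV \<sigma> \<circ> \<pi>))"
      by (simp add: irr_character_def left_translate_def[abs_def])
  qed
qed

lemma irr_character_inverse:
  assumes \<sigma>: "\<sigma> permutes {0..<sum_list lam}"
  shows "irr_character lam (inv_into UNIV \<sigma>) = cnj (irr_character lam \<sigma>)"
proof -
  obtain p where p: "reproducing_kernel {\<pi>. \<pi> permutes {0..<sum_list lam}} (specht_module lam) p"
    and chi: "\<And>\<sigma>. \<sigma> permutes {0..<sum_list lam} \<Longrightarrow> irr_character lam \<sigma>
      = (\<Sum>\<pi> | \<pi> permutes {0..<sum_list lam}. p \<pi> (inv_into UNIV \<sigma> \<circ> \<pi>))"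
    using irr_character_kernel[of lam] by blast
  show ?thesis
    unfolding chi[OF \<sigma>] chi[OF permutes_inv[OF \<sigma>]] permutes_inv_inv[OF \<sigma>]
    by (rule sum_kernel_inverse[OF p bij_betw_permutes_comp[OF permutes_inv[OF \<sigma>]]])
      (simp add: o_assoc permutes_inv_o[OF \<sigma>])
qed

lemma Re_irr_character_le:
  assumes \<sigma>: "\<sigma> permutes {0..<sum_list lam}"
  shows "Re (irr_character lam \<sigma>) \<le> Re (irr_character lam id)"
proof -
  obtain p where p: "reproducing_kernel {\<pi>. \<pi> permutes {0..<sum_list lam}} (specht_module lam) p"
    and chi: "\<And>\<sigma>. \<sigma> permutes {0..<sum_list lam} \<Longrightarrow> irr_character lam \<sigma>
      = (\<Sum>\<pi> | \<pi> permutes {0..<sum_list lam}. p \<pi> (inv_into UNIV \<sigma> \<circ> \<pi>))"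
    using irr_character_kernel[of lam] by blast
  show ?thesis
    using Re_sum_kernel_le[OF p bij_betw_permutes_comp[OF permutes_inv[OF \<sigma>]]]
    by (simp add: chi[OF \<sigma>] chi[OF permutes_id])
qed

lemma irr_character_id_nonneg: "0 \<le> irr_character lam id"
proof -
  obtain p where p: "reproducing_kernel {\<pi>. \<pi> permutes {0..<sum_list lam}} (specht_module lam) p"
    and chi: "\<And>\<sigma>. \<sigma> permutes {0..<sum_list lam} \<Longrightarrow> irr_character lam \<sigma>
      = (\<Sum>\<pi> | \<pi> permutes {0..<sum_list lam}. p \<pi> (inv_into UNIV \<sigma> \<circ> \<pi>))"
    using irr_character_kernel[of lam] by blast
  have "0 \<le> p \<pi> \<pi>" if "\<pi> permutes {0..<sum_list lam}" for \<pi>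
    using reproducing_kernel_inner[OF p, of \<pi> \<pi>, symmetric] that
    by (simp add: inner_on_self less_eq_complex_def sum_nonneg del: of_real_sum)
  then show ?thesis
    unfolding chi[OF permutes_id] by (intro sum_nonneg) simp
qed

section \<open>Comparing immanants with the permanent\<close>

text \<open>
  Symmetry makes the summands of \<open>\<psi>\<close> and \<open>\<psi>\<^sup>-\<^sup>1\<close> complex conjugates, so the immanant is real. Its real
  part is bounded summand by summand, since nonnegative products preserve \<open>Re (\<chi> \<psi>) \<le> \<chi> id\<close>.
\<close>

lemma normalized_immanant_le_permanent:
  fixes A :: "complex mat"
  assumes size: "sum_list lam = dim_row A"
    and sym: "\<And>i j. i < dim_row A \<Longrightarrow> j < dim_row A \<Longrightarrow> A $$ (j, i) = A $$ (i, j)"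
    and nonneg: "\<And>\<psi>. \<psi> permutes {0..<dim_row A} \<Longrightarrow> 0 \<le> (\<Prod>i = 0..<dim_row A. A $$ (i, \<psi> i))"
  shows "normalized_immanant lam A \<le> permanent A"
proof -
  let ?n = "dim_row A" and ?P = "{\<psi>. \<psi> permutes {0..<dim_row A}}"
  define a where "a \<psi> = (\<Prod>i = 0..<?n. A $$ (i, \<psi> i))" for \<psi>
  define c where "c = Re (irr_character lam id)"
  define N where "N = (\<Sum>\<psi>\<in>?P. irr_character lam \<psi> * a \<psi>)"
  have a_nonneg: "0 \<le> Re (a \<psi>)" "Im (a \<psi>) = 0" if "\<psi> \<in> ?P" for \<psi>
    using nonneg that by (simp_all add: a_def less_eq_complex_def)
  have a_inverse: "a (inv_into UNIV \<psi>) = a \<psi>" if "\<psi> \<in> ?P" for \<psi>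
  proof -
    have \<psi>: "\<psi> permutes {0..<?n}" using that by simp
    have "a (inv_into UNIV \<psi>) = (\<Prod>i = 0..<?n. A $$ (\<psi> i, inv_into UNIV \<psi> (\<psi> i)))"
      unfolding a_def
      using prod.permute[OF \<psi>, of "\<lambda>i. A $$ (i, inv_into UNIV \<psi> i)"] by (simp add: o_def)
    also have "\<dots> = (\<Prod>i = 0..<?n. A $$ (i, \<psi> i))"
      using permutes_in_image[OF \<psi>]
      by (intro prod.cong) (auto simp: permutes_inverses[OF \<psi>] intro!: sym)
    finally show ?thesis by (simp add: a_def)
  qed
  have id: "irr_character lam id = of_real c" "0 \<le> c"
    using irr_character_id_nonneg[of lam] by (auto simp: c_def less_eq_complex_def complex_eq_iff)
  have "N = (\<Sum>\<psi>\<in>?P. irr_character lam (inv_into UNIV \<psi>) * a (inv_into UNIV \<psi>))"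
    unfolding N_def by (rule sum.reindex_bij_betw[symmetric])
      (rule bij_betw_byWitness[where f' = "inv_into UNIV"],
        auto simp: permutes_inv_inv intro: permutes_inv)
  also have "\<dots> = cnj N"
    unfolding N_def cnj_sum
  proof (intro sum.cong refl)
    fix \<psi> assume \<psi>: "\<psi> \<in> ?P"
    have "cnj (a \<psi>) = a \<psi>" using a_nonneg[OF \<psi>] by (simp add: complex_eq_iff)
    then show "irr_character lam (inv_into UNIV \<psi>) * a (inv_into UNIV \<psi>)
      = cnj (irr_character lam \<psi> * a \<psi>)"
      using \<psi> by (simp add: a_inverse irr_character_inverse size)
  qed
  finally have ImN: "Im N = 0" by (simp add: complex_eq_iff)
  have "Re N \<le> (\<Sum>\<psi>\<in>?P. c * Re (a \<psi>))"
    unfolding N_def Re_sum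
  proof (rule sum_mono)
    fix \<psi> assume \<psi>: "\<psi> \<in> ?P"
    show "Re (irr_character lam \<psi> * a \<psi>) \<le> c * Re (a \<psi>)"
      using \<psi> a_nonneg[OF \<psi>] Re_irr_character_le[of \<psi> lam]
      by (simp add: c_def size mult_right_mono)
  qed
  also have "\<dots> = c * Re (permanent A)"
    by (simp add: permanent_def a_def Re_sum sum_distrib_left)
  finally have ReN: "Re N \<le> c * Re (permanent A)" .
  have perm: "Im (permanent A) = 0" "0 \<le> Re (permanent A)"
    using a_nonneg by (auto simp: permanent_def Im_sum Re_sum a_def[symmetric] intro: sum_nonneg)
  have "normalized_immanant lam A = N / of_real c"
    by (simp add: normalized_immanant_def N_def a_def id)
  then show ?thesis
    using ImN ReN perm \<open>0 \<le> c\<close>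
    \<comment> \<open>If \<open>c = 0\<close>, the quotient is zero, and nonnegativity of the permanent suffices.\<close>
    by (cases "c = 0") (auto simp: less_eq_complex_def Re_divide_of_real Im_divide_of_real
        divide_le_eq mult.commute)
qed

section \<open>Laplacian matrices of bipartite graphs\<close>

lemma complex_prod_nonneg:
  fixes f :: "'a \<Rightarrow> complex"
  assumes "\<And>i. i \<in> I \<Longrightarrow> 0 \<le> f i"
  shows "0 \<le> prod f I"
  using assms
  by (induction I rule: infinite_finite_induct) (auto simp: less_eq_complex_def)

lemma dim_row_laplacian_matrix: "dim_row (laplacian_matrix n G) = n"
  by (simp add: laplacian_matrix_def adjacency_matrix_def)

lemma laplacian_matrix_entry:
  assumes "i < n" "j < n"
  shows "laplacian_matrix n G $$ (i, j) =
    (if i = j then of_nat (out_degree (with_proj G) i) else 0) - of_bool ((i, j) \<in> parcs G)"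
  using assms by (simp add: laplacian_matrix_def degree_matrix_def adjacency_matrix_def)

text \<open>
  Every off-diagonal nonzero entry of the Laplacian is \<open>-1\<close> and joins the two sides of the
  bipartition. Giving the sides opposite signs turns all entries nonnegative, and the signs of the
  rows cancel against those of the columns since \<open>\<psi>\<close> is a bijection.
\<close>

lemma bipartite_laplacian_diagonal_product_nonneg:
  assumes "bipartite G" and \<psi>: "\<psi> permutes {0..<n}"
  shows "0 \<le> (\<Prod>i = 0..<n. laplacian_matrix n G $$ (i, \<psi> i))"
proof -
  obtain U W where UW: "U \<inter> W = {}" "parcs G \<subseteq> U \<times> W \<union> W \<times> U"
    using assms(1) by (auto simp: bipartite_def)
  define s :: "nat \<Rightarrow> complex" where "s i = (if i \<in> U then 1 else - 1)" for i
  let ?L = "\<lambda>i j. laplacian_matrix n G $$ (i, j)"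
  have s2: "s i * s i = 1" for i by (simp add: s_def)
  have entry: "0 \<le> s i * s j * ?L i j" if "i < n" "j < n" for i j
  proof (cases "(i, j) \<in> parcs G")
    case True
    then have "i \<noteq> j" "s i * s j = - 1" using UW by (auto simp: s_def)
    then show ?thesis using that True
      by (simp add: laplacian_matrix_entry less_eq_complex_def)
  next
    case False
    moreover have "(0 :: complex) \<le> of_nat k" for k by (simp add: less_eq_complex_def)
    ultimately show ?thesis using that s2 by (simp add: laplacian_matrix_entry)
  qed
  have "0 \<le> (\<Prod>i = 0..<n. s i * s (\<psi> i) * ?L i (\<psi> i))"
    using permutes_in_image[OF \<psi>] by (intro complex_prod_nonneg entry) auto
  also have "\<dots> = (\<Prod>i = 0..<n. s i) * (\<Prod>i = 0..<n. s (\<psi> i)) * (\<Prod>i = 0..<n. ?L i (\<psi> i))"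
    by (simp add: prod.distrib)
  also have "(\<Prod>i = 0..<n. s (\<psi> i)) = (\<Prod>i = 0..<n. s i)"
    using prod.permute[OF \<psi>, of s] by (simp add: o_def)
  also have "(\<Prod>i = 0..<n. s i) * (\<Prod>i = 0..<n. s i) = 1"
    by (simp add: s2 flip: prod.distrib)
  finally show ?thesis by simp
qed

theorem theorem8:
  fixes n :: nat and G :: "nat pair_pre_digraph" and lam :: "nat list"
  assumes "pair_graph G"
    and "pverts G = {0..<n}"
    and "Digraph_Component.connected (with_proj G)"
    and "bipartite G"
    and "lam \<turnstile> n"
  shows "normalized_immanant lam (laplacian_matrix n G) \<le> permanent (laplacian_matrix n G)"
proof (rule normalized_immanant_le_permanent)
  show "sum_list lam = dim_row (laplacian_matrix n G)"
    using assms(5) by (simp add: is_partition_def dim_row_laplacian_matrix)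
next
  interpret pair_graph G by fact
  fix i j assume "i < dim_row (laplacian_matrix n G)" "j < dim_row (laplacian_matrix n G)"
  then show "laplacian_matrix n G $$ (j, i) = laplacian_matrix n G $$ (i, j)"
    using arcs_symmetric by (auto simp: dim_row_laplacian_matrix laplacian_matrix_entry)
next
  fix \<psi> assume "\<psi> permutes {0..<dim_row (laplacian_matrix n G)}"
  then show "0 \<le> (\<Prod>i = 0..<dim_row (laplacian_matrix n G). laplacian_matrix n G $$ (i, \<psi> i))"
    using bipartite_laplacian_diagonal_product_nonneg[OF assms(4)]
    by (simp add: dim_row_laplacian_matrix)
qed

end
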